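(* Let $\mathcal{S}$ be the closed ball of center $S_0\in\mathbb{R}^3$ and radius $R_0>0$, let $X$ be uniformly distributed in $\mathcal{S}$, let $P\in\mathbb{R}^3$, let $R_1=\|\overrightarrow{S_0P}\|_2$, and set $D=\|\overrightarrow{PX}\|_2$. When $R_1>0$ put $$h_1(d)=d-R_1+\frac{R_0^2+R_1^2-d^2}{2R_1},\qquad h_2(d)=R_0-\frac{R_0^2+R_1^2-d^2}{2R_1},$$ $$G(d)=\frac{1}{4R_0^3}\Big[h_1(d)^2(3d-h_1(d))+h_2(d)^2(3R_0-h_2(d))\Big],$$ $$g(d)=\frac{3}{4\pi R_0^3}\left[\pi h_1(d)^2+\left(1-\frac{d}{R_1}\right)\pi h_1(d)\,(2d-h_1(d))+\frac{d}{R_1}\,\pi h_2(d)\,(2R_0-h_2(d))\right].$$ Then the cumulative distribution function $F_D$ of $D$ and a probability density $f_D$ of $D$ are given as follows. (1) If $R_1=0$: $F_D(d)=f_D(d)=0$ for $d<0$; $F_D(d)=\frac{d^3}{R_0^3}$ and $f_D(d)=\frac{3d^2}{R_0^3}$ for $0\le d\le R_0$; $F_D(d)=1$ and $f_D(d)=0$ for $d>R_0$. (2) If $0<R_1<R_0$: $F_D(d)=f_D(d)=0$ for $d<0$; $F_D(d)=\frac{d^3}{R_0^3}$ and $f_D(d)=\frac{3d^2}{R_0^3}$ for $0\le d\le R_0-R_1$; $F_D(d)=G(d)$ and $f_D(d)=g(d)$ for $R_0-R_1<d\le R_0+R_1$; $F_D(d)=1$ and $f_D(d)=0$ for $d>R_0+R_1$.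 (3) If $R_1\ge R_0$: $F_D(d)=f_D(d)=0$ for $d<R_1-R_0$; $F_D(d)=G(d)$ and $f_D(d)=g(d)$ for $R_1-R_0\le d\le R_1+R_0$; $F_D(d)=1$ and $f_D(d)=0$ for $d>R_1+R_0$.
   Context: "Uniformly distributed in $\mathcal{S}$" means with respect to normalized three-dimensional Lebesgue measure on $\mathcal{S}$. $F_D(d)=\mathbb{P}(D\le d)$. A probability density of $D$ is a nonnegative function $f_D$ with $F_D(d)=\int_{-\infty}^d f_D(t)\,dt$ for all $d\in\mathbb{R}$ (it is determined up to a Lebesgue-null set). *)

theory Defs
  imports "HOL-Probability.Probability"
begin

text \<open>
  Uniform distribution on a set with respect to normalized Lebesgue measure. It is stated on
  Borel sets, like all distributions of Borel random variables in the library.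
\<close>
definition uniformly_distributed ::
    "'w measure \<Rightarrow> ('w \<Rightarrow> 'b::euclidean_space) \<Rightarrow> 'b set \<Rightarrow> bool" where
  "uniformly_distributed M X A \<longleftrightarrow>
     X \<in> borel_measurable M \<and> distr M borel X = uniform_measure lborel A"

text \<open>
  Integrability is required explicitly because the Bochner integral of a non-integrable
  function is 0 by convention.
\<close>
definition is_prob_density :: "'w measure \<Rightarrow> ('w \<Rightarrow> real) \<Rightarrow> (real \<Rightarrow> real) \<Rightarrow> bool" where
  "is_prob_density M D f \<longleftrightarrow>
     (\<forall>t. 0 \<le> f t) \<and>
     (\<forall>d. set_integrable lborel {..d} f \<and>
          cdf (distr M borel D) d = (LINT t:{..d}|lborel. f t))"

text \<open>
  The height of the cap of the ball of radius \<open>d\<close> around \<open>P\<close> (for \<open>h1\<close>), respectively of the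
  ball of radius \<open>R0\<close> around \<open>S0\<close> (for \<open>h2\<close>), cut off by the plane through the circle in which
  the two bounding spheres meet; \<open>R1\<close> is the distance of the centers. Only meaningful
  for \<open>R1 > 0\<close>.
\<close>
definition h1 :: "real \<Rightarrow> real \<Rightarrow> real \<Rightarrow> real" where
  "h1 R0 R1 d = d - R1 + (R0\<^sup>2 + R1\<^sup>2 - d\<^sup>2) / (2 * R1)"

definition h2 :: "real \<Rightarrow> real \<Rightarrow> real \<Rightarrow> real" where
  "h2 R0 R1 d = R0 - (R0\<^sup>2 + R1\<^sup>2 - d\<^sup>2) / (2 * R1)"

definition G :: "real \<Rightarrow> real \<Rightarrow> real \<Rightarrow> real" where
  "G R0 R1 d = 1 / (4 * R0 ^ 3) *
     ((h1 R0 R1 d)\<^sup>2 * (3 * d - h1 R0 R1 d) + (h2 R0 R1 d)\<^sup>2 * (3 * R0 - h2 R0 R1 d))"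

definition g :: "real \<Rightarrow> real \<Rightarrow> real \<Rightarrow> real" where
  "g R0 R1 d = 3 / (4 * pi * R0 ^ 3) *
     (pi * (h1 R0 R1 d)\<^sup>2
      + (1 - d / R1) * pi * h1 R0 R1 d * (2 * d - h1 R0 R1 d)
      + d / R1 * pi * h2 R0 R1 d * (2 * R0 - h2 R0 R1 d))"

end

theory Submission
  imports Defs
begin

text \<open>
  The value \<open>F d\<close> is the share of the ball of radius \<open>R0\<close> around \<open>S0\<close> that lies in the ball of
  radius \<open>d\<close> around \<open>P\<close>. Unless one ball contains the other or the two are disjoint, their
  intersection is a lens. The plane through the circle in which the two spheres meet cuts it
  into two spherical caps, one of each ball, of heights \<open>h2\<close> and \<open>h1\<close>. A cap of height \<open>h\<close> of a
  ball of radius \<open>r\<close> has volume \<open>\<pi> h\<^sup>2 (3 r - h) / 3\<close> (\<open>measure_cap\<close>), so the volume of the lens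
  divided by that of the ball is \<open>G\<close> (\<open>measure_lens\<close>, \<open>measure_cball_Int_cball\<close>).

  The cap volume comes from Cavalieri's principle: the slices orthogonal to the axis of the cap
  are discs, and their areas integrate to a cubic polynomial. A rotation and a translation
  reduce the general cap to one around the first coordinate axis.

  For the density, \<open>g\<close> is the derivative of \<open>G\<close> (\<open>DERIV_G\<close>), and the pieces of the distribution
  function agree where they meet (\<open>G_lower\<close>, \<open>G_upper\<close>). The distribution function is therefore
  continuous and differentiable outside at most four points, and the fundamental theorem of
  calculus recovers it from its derivative. That derivative is nonnegative because \<open>g\<close> is, up to
  the normalization, the area of the part of the sphere of radius \<open>d\<close> around \<open>P\<close> that lies in the
  given ball (\<open>g_eq_cap_area\<close>).
\<close>

section \<open>The volume of a spherical cap\<close>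

lemma borel_measurable_vector_3:
  "(\<lambda>(x, y, z). vector [x, y, z] :: real ^ 3) \<in> borel_measurable borel"
proof (rule borel_measurable_continuous_onI)
  have "(\<lambda>(x, y, z). vector [x, y, z] :: real ^ 3)
      = (\<lambda>p. fst p *\<^sub>R axis 1 1 + fst (snd p) *\<^sub>R axis 2 1 + snd (snd p) *\<^sub>R axis 3 1)"
    by (simp add: fun_eq_iff vec_eq_iff forall_3 axis_def)
  then show "continuous_on UNIV (\<lambda>(x, y, z). vector [x, y, z] :: real ^ 3)"
    by (simp only:) (intro continuous_intros)
qed

lemma emeasure_lborel_Times:
  fixes A :: "'a::euclidean_space set" and B :: "'b::euclidean_space set"
  assumes "A \<in> sets borel" "B \<in> sets borel"
  shows "emeasure lborel (A \<times> B) = emeasure lborel A * emeasure lborel B"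
  using assms by (simp add: lborel_prod[symmetric] lborel.emeasure_pair_measure_Times)

text \<open>
  Seen through this map, the first coordinate splits off as a factor of a product measure, so
  that volumes in \<open>real ^ 3\<close> become integrals over slices.
\<close>
lemma lborel_eq_distr_vector_3:
  "distr (lborel :: (real \<times> real \<times> real) measure) borel (\<lambda>(x, y, z). vector [x, y, z])
     = (lborel :: (real ^ 3) measure)"
proof -
  let ?T = "\<lambda>(x, y, z). vector [x, y, z] :: real ^ 3"
  show ?thesis
  proof (rule lborel_eqI[symmetric])
    fix l u :: "real ^ 3"
    assume lu: "\<And>b. b \<in> Basis \<Longrightarrow> l \<bullet> b \<le> u \<bullet> b"
    have le: "l $ i \<le> u $ i" for i
      using lu[of "axis i 1"] by (simp add: cart_eq_inner_axis)
    have vimage: "?T -` box l u = box (l $ 1) (u $ 1) \<times> box (l $ 2) (u $ 2) \<times> box (l $ 3) (u $ 3)"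
      by (auto simp: mem_box_cart forall_3 box_real)
    have "emeasure (distr lborel borel ?T) (box l u)
        = emeasure lborel (box (l $ 1) (u $ 1) \<times> box (l $ 2) (u $ 2) \<times> box (l $ 3) (u $ 3))"
      using borel_measurable_vector_3 by (subst emeasure_distr) (auto simp: vimage)
    also have "\<dots> = ennreal ((u $ 1 - l $ 1) * ((u $ 2 - l $ 2) * (u $ 3 - l $ 3)))"
      using le[of 1] le[of 2] le[of 3]
      by (simp add: box_real emeasure_lborel_Times borel_Times ennreal_mult[symmetric] del: lborel_prod)
    also have "(u $ 1 - l $ 1) * ((u $ 2 - l $ 2) * (u $ 3 - l $ 3)) = (\<Prod>b\<in>Basis. (u - l) \<bullet> b)"
    proof -
      have "(\<Prod>b\<in>Basis. (u - l) \<bullet> b) = (\<Prod>i\<in>UNIV. (u - l) \<bullet> axis i 1)"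
        by (subst prod.reindex[of "\<lambda>i. axis i (1::real)", unfolded o_def, symmetric])
           (auto simp: inj_on_def axis_eq_axis Basis_vec_def intro!: prod.cong)
      then show ?thesis
        unfolding UNIV_3 by (simp add: cart_eq_inner_axis[symmetric] mult.assoc)
    qed
    finally show "emeasure (distr lborel borel ?T) (box l u) = ennreal (\<Prod>b\<in>Basis. (u - l) \<bullet> b)" .
  qed simp
qed

text \<open>
  The slice at height \<open>s\<close> is a disc of squared radius \<open>r\<^sup>2 - s\<^sup>2\<close>. Taking the slices in
  \<open>real \<times> real\<close> makes the disc a ball of a Euclidean space, whose area is known.
\<close>
lemma emeasure_cap_prod:
  fixes r h :: real
  assumes h: "0 \<le> h" "h \<le> 2 * r"
  shows "emeasure lborel {p :: real \<times> real \<times> real. norm p \<le> r \<and> r - h \<le> fst p}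
    = ennreal (pi / 3 * h\<^sup>2 * (3 * r - h))"
proof -
  let ?A = "{p :: real \<times> real \<times> real. norm p \<le> r \<and> r - h \<le> fst p}"
  have r: "0 \<le> r" using h by simp
  have "closed ?A"
    by (intro closed_Collect_conj closed_Collect_le continuous_intros)
  then have A: "?A \<in> sets (lborel \<Otimes>\<^sub>M lborel)"
    unfolding lborel_prod by simp
  have slice: "emeasure lborel (Pair s -` ?A)
      = ennreal (pi * (r\<^sup>2 - s\<^sup>2)) * indicator {r - h..r} s" for s
  proof (cases "r - h \<le> s \<and> s \<le> r")
    case True
    then have s: "s\<^sup>2 \<le> r\<^sup>2"
      using h by (intro abs_le_square_iff[THEN iffD1]) auto
    have "norm (s, y) \<le> r \<longleftrightarrow> norm y \<le> sqrt (r\<^sup>2 - s\<^sup>2)" for y :: "real \<times> real"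
    proof -
      have "norm (s, y) \<le> r \<longleftrightarrow> (norm (s, y))\<^sup>2 \<le> r\<^sup>2"
        using r by (simp add: abs_le_square_iff[symmetric])
      also have "\<dots> \<longleftrightarrow> (norm y)\<^sup>2 \<le> (sqrt (r\<^sup>2 - s\<^sup>2))\<^sup>2"
        using s by (simp add: norm_Pair) linarith
      also have "\<dots> \<longleftrightarrow> norm y \<le> sqrt (r\<^sup>2 - s\<^sup>2)"
        using s by (subst abs_le_square_iff[symmetric]) simp
      finally show ?thesis .
    qed
    then have "Pair s -` ?A = cball 0 (sqrt (r\<^sup>2 - s\<^sup>2))"
      using True by auto
    then show ?thesis
      using True s by (simp add: emeasure_cball eval_unit_ball_vol)
  next
    case False
    have "s \<le> norm (s, y)" for y :: "real \<times> real"
      by (metis abs_le_D1 norm_fst_le real_norm_def fst_conv)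
    then have "\<not> (norm (s, y) \<le> r \<and> r - h \<le> s)" for y :: "real \<times> real"
      using False order_trans[of s "norm (s, y)" r] by blast
    then have empty: "Pair s -` ?A = {}"
      by simp
    show ?thesis unfolding empty using False by simp
  qed
  let ?H = "\<lambda>s. pi * (r\<^sup>2 * s - s ^ 3 / 3)"
  have "emeasure lborel ?A = (\<integral>\<^sup>+s. emeasure lborel (Pair s -` ?A) \<partial>lborel)"
    using lborel.emeasure_pair_measure_alt[OF A] by (simp add: lborel_prod)
  also have "\<dots> = ennreal (?H r - ?H (r - h))"
    unfolding slice
  proof (rule nn_integral_FTC_Icc)
    show "DERIV ?H s :> pi * (r\<^sup>2 - s\<^sup>2)" for s
      by (auto intro!: derivative_eq_intros simp: power2_eq_square)
    show "0 \<le> pi * (r\<^sup>2 - s\<^sup>2)" if "s \<in> {r - h..r}" for s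
      using h that abs_le_square_iff[of s r] by auto
  qed (use h in auto)
  also have "?H r - ?H (r - h) = pi / 3 * h\<^sup>2 * (3 * r - h)"
    by (simp add: field_simps power2_eq_square power3_eq_cube)
  finally show ?thesis .
qed

text \<open>
  Lebesgue measure is invariant under rotations and translations, so it suffices to consider
  the cap around the first coordinate axis of the ball at the origin. Caps larger than a
  half-ball (\<open>h > r\<close>) occur as well, since the centers may lie on the same side of the plane in
  which the spheres meet.
\<close>
lemma
  fixes c e :: "real ^ 3" and r h :: real
  assumes e: "norm e = 1" and h: "0 \<le> h" "h \<le> 2 * r"
  shows lmeasurable_cap: "{x. norm (x - c) \<le> r \<and> r - h \<le> (x - c) \<bullet> e} \<in> lmeasurable"
    and measure_cap: "measure lebesgue {x. norm (x - c) \<le> r \<and> r - h \<le> (x - c) \<bullet> e}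
      = pi / 3 * h\<^sup>2 * (3 * r - h)"
proof -
  let ?cap = "\<lambda>c e. {x. norm (x - c) \<le> r \<and> r - h \<le> (x - c) \<bullet> e} :: (real ^ 3) set"
  have compact: "compact (?cap c e)" for c e
  proof -
    have "?cap c e = cball c r \<inter> {x. r - h \<le> (x - c) \<bullet> e}"
      by (auto simp: dist_norm norm_minus_commute)
    then show ?thesis
      by (auto intro!: compact_Int_closed closed_Collect_le continuous_intros)
  qed
  show "?cap c e \<in> lmeasurable"
    by (rule lmeasurable_compact[OF compact])
  let ?u = "axis 1 1 :: real ^ 3"
  obtain f where f: "orthogonal_transformation f" "f ?u = e"
    using orthogonal_transformation_exists[of ?u e] e by auto
  have image: "?cap c e = (+) c ` f ` ?cap 0 ?u"
  proof -
    have "surj f"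
      using f(1) by (rule orthogonal_transformation_surj)
    have 1: "norm (f y) = norm y" "f y \<bullet> e = y \<bullet> ?u" for y
      using f by (auto simp: orthogonal_transformation_norm orthogonal_transformation_def)
    show ?thesis
    proof (intro equalityI subsetI)
      fix x assume "x \<in> ?cap c e"
      moreover obtain y where "f y = x - c"
        using \<open>surj f\<close> by (metis surjD)
      ultimately show "x \<in> (+) c ` f ` ?cap 0 ?u"
        using 1[of y] by (intro image_eqI[of _ _ "f y"] image_eqI[of _ _ y]) auto
    qed (auto simp: 1)
  qed
  have "measure lebesgue (?cap c e) = measure lebesgue (?cap 0 ?u)"
    unfolding image measure_translation
    by (rule measure_orthogonal_image[OF f(1) lmeasurable_compact[OF compact]])
  also have "\<dots> = measure lborel (?cap 0 ?u)"
    using compact[of 0 ?u] by (auto intro!: measure_completion borel_closed compact_imp_closed)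
  also have "\<dots> = pi / 3 * h\<^sup>2 * (3 * r - h)"
  proof -
    let ?T = "\<lambda>(x, y, z). vector [x, y, z] :: real ^ 3"
    have "?T -` ?cap 0 ?u = {p. norm p \<le> r \<and> r - h \<le> fst p}"
      by (auto simp: norm_Pair norm_vec_def L2_set_def sum_3 inner_axis add.assoc)
    then have "emeasure lborel (?cap 0 ?u) = ennreal (pi / 3 * h\<^sup>2 * (3 * r - h))"
      unfolding lborel_eq_distr_vector_3[symmetric]
      using borel_measurable_vector_3 compact[of 0 ?u] h
      by (subst emeasure_distr) (auto simp: emeasure_cap_prod[OF h] intro!: borel_closed compact_imp_closed)
    then show ?thesis
      using h by (simp add: measure_def)
  qed
  finally show "measure lebesgue (?cap c e) = pi / 3 * h\<^sup>2 * (3 * r - h)" .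
qed

section \<open>The volume of the intersection of two balls\<close>

text \<open>
  The factors of \<open>h\<close> and \<open>2 r - h\<close> are those of Heron's formula for the triangle with
  sides \<open>R0\<close>, \<open>R1\<close>, \<open>d\<close>. Their signs show when the cap heights lie in the range \<open>{0..2 r}\<close>.
\<close>
lemma h1_factored: "R1 \<noteq> 0 \<Longrightarrow> h1 R0 R1 d = (R0 + R1 - d) * (d + R0 - R1) / (2 * R1)"
  by (simp add: h1_def field_simps power2_eq_square)

lemma h2_factored: "R1 \<noteq> 0 \<Longrightarrow> h2 R0 R1 d = (d + R0 - R1) * (d + R1 - R0) / (2 * R1)"
  by (simp add: h2_def field_simps power2_eq_square)

lemma h1_opposite_factored:
  "R1 \<noteq> 0 \<Longrightarrow> 2 * d - h1 R0 R1 d = (d + R1 - R0) * (R0 + R1 + d) / (2 * R1)"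
  by (simp add: h1_def field_simps power2_eq_square)

lemma h2_opposite_factored:
  "R1 \<noteq> 0 \<Longrightarrow> 2 * R0 - h2 R0 R1 d = (R0 + R1 - d) * (R0 + R1 + d) / (2 * R1)"
  by (simp add: h2_def field_simps power2_eq_square)

text \<open>
  With \<open>u\<close> the coordinate of \<open>x\<close> along the axis from \<open>S0\<close> to \<open>P\<close>, subtracting the two sphere
  equations gives a linear equation \<open>u = t\<close>. On the side \<open>u \<ge> t\<close> the ball around \<open>S0\<close> is the
  tighter constraint, on the other side the ball around \<open>P\<close> is. Hence the lens is the union of
  two caps, which overlap only in a plane.
\<close>
lemma measure_lens:
  fixes S0 P :: "real ^ 3" and R0 d :: real
  defines "R1 \<equiv> norm (P - S0)"
  assumes R: "R0 > 0" "R1 > 0" and d: "\<bar>R0 - R1\<bar> \<le> d" "d \<le> R0 + R1"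
  shows "measure lborel (cball S0 R0 \<inter> cball P d) = 4 / 3 * pi * R0 ^ 3 * G R0 R1 d"
proof -
  define e where "e = (P - S0) /\<^sub>R R1"
  define t where "t = (R0\<^sup>2 + R1\<^sup>2 - d\<^sup>2) / (2 * R1)"
  let ?h1 = "h1 R0 R1 d" and ?h2 = "h2 R0 R1 d"
  let ?A = "{x. norm (x - S0) \<le> R0 \<and> R0 - ?h2 \<le> (x - S0) \<bullet> e}"
  let ?B = "{x. norm (x - P) \<le> d \<and> d - ?h1 \<le> (x - P) \<bullet> (- e)}"
  have e: "norm e = 1" using R by (simp add: e_def R1_def)
  have P: "P = S0 + R1 *\<^sub>R e" using R by (simp add: e_def)
  have t: "R0 - ?h2 = t" "d - ?h1 = R1 - t" "2 * R1 * t = R0\<^sup>2 + R1\<^sup>2 - d\<^sup>2"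
    using R by (simp_all add: h1_def h2_def t_def)
  have h: "0 \<le> ?h1" "?h1 \<le> 2 * d" "0 \<le> ?h2" "?h2 \<le> 2 * R0"
  proof -
    have "0 \<le> 2 * d - ?h1" "0 \<le> 2 * R0 - ?h2"
      using d R by (auto simp: h1_opposite_factored h2_opposite_factored
          intro!: divide_nonneg_pos mult_nonneg_nonneg)
    then show "?h1 \<le> 2 * d" "?h2 \<le> 2 * R0"
      by linarith+
    show "0 \<le> ?h1" "0 \<le> ?h2"
      using d R by (auto simp: h1_factored h2_factored intro!: divide_nonneg_pos mult_nonneg_nonneg)
  qed
  \<comment> \<open>The law of cosines, from which both inclusions of the cap decomposition follow.\<close>
  have dist_P: "(norm (x - P))\<^sup>2 = (norm (x - S0))\<^sup>2 - 2 * R1 * ((x - S0) \<bullet> e) + R1\<^sup>2" for x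
  proof -
    have "e \<bullet> e = 1" using e by (simp add: norm_eq_1)
    have "(norm (v - R1 *\<^sub>R e))\<^sup>2 = (norm v)\<^sup>2 - 2 * R1 * (v \<bullet> e) + R1\<^sup>2" for v
      unfolding power2_norm_eq_inner using \<open>e \<bullet> e = 1\<close>
      by (simp add: inner_diff_left inner_diff_right inner_commute[of e v] power2_eq_square
          right_diff_distrib)
    from this[of "x - S0"] show ?thesis
      by (simp only: P diff_diff_add)
  qed
  have height: "(x - P) \<bullet> (- e) = R1 - (x - S0) \<bullet> e" for x
  proof -
    have "e \<bullet> e = 1" using e by (simp add: norm_eq_1)
    then show ?thesis by (simp add: P inner_diff_left inner_add_left)
  qed
  have eq: "cball S0 R0 \<inter> cball P d = ?A \<union> ?B"
  proof -
    have d0: "0 \<le> d" using d by simp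
    have A: "norm (x - P) \<le> d" if "norm (x - S0) \<le> R0" "t \<le> (x - S0) \<bullet> e" for x
    proof (rule power2_le_imp_le[OF _ d0])
      have "(norm (x - S0))\<^sup>2 \<le> R0\<^sup>2" "2 * R1 * t \<le> 2 * R1 * ((x - S0) \<bullet> e)"
        using that R by (auto intro: power_mono)
      then show "(norm (x - P))\<^sup>2 \<le> d\<^sup>2" using t(3) by (simp add: dist_P)
    qed
    have B: "norm (x - S0) \<le> R0" if "norm (x - P) \<le> d" "(x - S0) \<bullet> e \<le> t" for x
    proof (rule power2_le_imp_le)
      have "(norm (x - P))\<^sup>2 \<le> d\<^sup>2" "2 * R1 * ((x - S0) \<bullet> e) \<le> 2 * R1 * t"
        using that R by (auto intro: power_mono)
      then show "(norm (x - S0))\<^sup>2 \<le> R0\<^sup>2" using t(3) dist_P[of x] by simp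
    qed (use R in simp)
    have "x \<in> cball S0 R0 \<inter> cball P d \<longleftrightarrow> x \<in> ?A \<union> ?B" for x
      using A[of x] B[of x] unfolding mem_Collect_eq Un_iff Int_iff mem_cball dist_norm t height
      by (auto simp: norm_minus_commute)
    then show ?thesis by blast
  qed
  have caps: "?A \<in> lmeasurable" "?B \<in> lmeasurable"
    by (rule lmeasurable_cap; use e h in simp)+
  have "?A \<inter> ?B \<subseteq> {x. e \<bullet> x = t + e \<bullet> S0}"
    unfolding t height by (auto simp: inner_diff_left inner_commute[of e])
  moreover have "e \<noteq> 0" using e by auto
  ultimately have "negligible (?A \<inter> ?B)"
    using negligible_subset[OF negligible_hyperplane] by blast
  then have "measure lebesgue (?A \<union> ?B) = measure lebesgue ?A + measure lebesgue ?B"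
    unfolding measure_Un3[OF caps] by (simp only: negligible_imp_measure0 diff_0_right)
  also have "\<dots> = pi / 3 * ?h2\<^sup>2 * (3 * R0 - ?h2) + pi / 3 * ?h1\<^sup>2 * (3 * d - ?h1)"
    using e h by (simp only: measure_cap norm_minus_cancel)
  also have "\<dots> = 4 / 3 * pi * R0 ^ 3 * G R0 R1 d"
    using R by (simp add: G_def field_simps)
  finally show ?thesis
    unfolding eq[symmetric] by simp
qed

text \<open>
  One formula for all positions of \<open>P\<close>: for \<open>d \<ge> 0\<close>, the two balls are disjoint if
  \<open>d < R1 - R0\<close>, and the ball around \<open>P\<close> is contained in the other one if \<open>d \<le> R0 - R1\<close>. For
  \<open>R1 = 0\<close> these cases leave no \<open>d\<close> at which \<open>G\<close>, meaningless there, would be used.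
\<close>
definition dist_cdf :: "real \<Rightarrow> real \<Rightarrow> real \<Rightarrow> real" where
  "dist_cdf R0 R1 d =
     (if d < 0 \<or> d < R1 - R0 then 0
      else if d \<le> R0 - R1 then d ^ 3 / R0 ^ 3
      else if d \<le> R0 + R1 then G R0 R1 d
      else 1)"

lemma measure_cball_Int_cball:
  fixes S0 P :: "real ^ 3"
  assumes R0: "R0 > 0"
  shows "measure lborel (cball S0 R0 \<inter> cball P d)
    = 4 / 3 * pi * R0 ^ 3 * dist_cdf R0 (norm (P - S0)) d"
proof -
  let ?R1 = "norm (P - S0)"
  have ball: "measure lborel (cball c r) = 4 / 3 * pi * r ^ 3" if "0 \<le> r" for c :: "real ^ 3" and r
    using that by (simp add: content_cball eval_unit_ball_vol)
  have dist: "dist S0 P = ?R1"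
    by (simp add: dist_norm norm_minus_commute)
  consider "d < 0 \<or> d < ?R1 - R0" | "0 \<le> d" "?R1 - R0 \<le> d" "d \<le> R0 - ?R1"
    | "\<bar>R0 - ?R1\<bar> \<le> d" "d \<le> R0 + ?R1" "R0 - ?R1 < d" | "0 \<le> d" "R0 + ?R1 < d"
    using norm_ge_zero[of "P - S0"] by linarith
  then show ?thesis
  proof cases
    case 1
    have "cball S0 R0 \<inter> cball P d = {}"
    proof (rule ccontr)
      assume "cball S0 R0 \<inter> cball P d \<noteq> {}"
      then obtain x where x: "dist S0 x \<le> R0" "dist P x \<le> d" by auto
      moreover have "dist S0 P \<le> dist S0 x + dist P x" "0 \<le> dist P x"
        by (auto simp: dist_triangle2)
      ultimately show False using 1 dist by linarith
    qed
    then show ?thesis using 1 by (simp add: dist_cdf_def)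
  next
    case 2
    then have "cball P d \<subseteq> cball S0 R0"
      using dist by (simp add: cball_subset_cball_iff dist_commute)
    then have "cball S0 R0 \<inter> cball P d = cball P d" by blast
    then show ?thesis using 2 R0 ball by (simp add: dist_cdf_def)
  next
    case 3
    then have "?R1 > 0" using R0 norm_ge_zero[of "P - S0"] by linarith
    then show ?thesis
      using measure_lens[OF R0 _ 3(1,2)] 3 by (auto simp: dist_cdf_def abs_le_iff)
  next
    case 4
    then have "cball S0 R0 \<subseteq> cball P d"
      using dist by (simp add: cball_subset_cball_iff)
    then have "cball S0 R0 \<inter> cball P d = cball S0 R0" by blast
    then show ?thesis using 4 R0 ball norm_ge_zero[of "P - S0"]
      by (auto simp add: dist_cdf_def simp del: norm_ge_zero)
  qed
qed

section \<open>The density\<close>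

text \<open>
  The next two lemmas give the values at the ends of the lens range. There the lens
  degenerates to the whole ball, to the ball around \<open>P\<close>, or to a point.
\<close>
lemma G_upper:
  assumes "R0 > 0" "R1 > 0"
  shows "G R0 R1 (R0 + R1) = 1"
proof -
  have "h1 R0 R1 (R0 + R1) = 0" "h2 R0 R1 (R0 + R1) = 2 * R0"
    using assms by (simp_all add: h1_factored h2_factored)
  then show ?thesis
    using assms by (simp add: G_def power2_eq_square power3_eq_cube)
qed

lemma G_lower:
  assumes "R0 > 0" "R1 > 0"
  shows "G R0 R1 \<bar>R0 - R1\<bar> = (max 0 (R0 - R1)) ^ 3 / R0 ^ 3"
proof -
  have h: "h1 R0 R1 \<bar>R0 - R1\<bar> = 2 * max 0 (R0 - R1)" "h2 R0 R1 \<bar>R0 - R1\<bar> = 0"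
    using assms by (simp_all add: h1_factored h2_factored abs_if)
  have "1 / (4 * R0 ^ 3) * ((2 * m)\<^sup>2 * (3 * m - 2 * m) + 0\<^sup>2 * (3 * R0 - 0)) = m ^ 3 / R0 ^ 3" for m
    by (simp add: power2_eq_square power3_eq_cube)
  from this[of "max 0 (R0 - R1)"] show ?thesis
    unfolding G_def h by (cases "R0 \<le> R1") simp_all
qed

text \<open>
  The heights have derivatives \<open>1 - d / R1\<close> and \<open>d / R1\<close>; for a cap of height \<open>f\<close> of a ball of
  radius \<open>r\<close>, both depending on \<open>d\<close>, the product rule turns \<open>f\<^sup>2 (3 r - f)\<close> into
  \<open>3 (f\<^sup>2 r' + f' f (2 r - f))\<close>. The three terms of \<open>g\<close> arise in this way.
\<close>
lemma DERIV_G: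
  assumes "R0 > 0" "R1 > 0"
  shows "(G R0 R1 has_real_derivative g R0 R1 d) (at d)"
proof -
  let ?h1 = "h1 R0 R1" and ?h2 = "h2 R0 R1"
  have h: "(?h1 has_real_derivative 1 - d / R1) (at d)" "(?h2 has_real_derivative d / R1) (at d)"
    unfolding h1_def[abs_def] h2_def[abs_def] using assms
    by (auto intro!: derivative_eq_intros simp: field_simps)
  have cap: "((\<lambda>x. (f x)\<^sup>2 * (3 * r x - f x)) has_real_derivative
      3 * ((f d)\<^sup>2 * r' + f' * f d * (2 * r d - f d))) (at d)"
    if "(f has_real_derivative f') (at d)" "(r has_real_derivative r') (at d)" for f r f' r'
    by (rule DERIV_cong, (rule derivative_eq_intros that refl)+)
       (simp add: algebra_simps power2_eq_square)
  have "(G R0 R1 has_real_derivative 1 / (4 * R0 ^ 3) *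
      (3 * ((?h1 d)\<^sup>2 * 1 + (1 - d / R1) * ?h1 d * (2 * d - ?h1 d)) +
       3 * ((?h2 d)\<^sup>2 * 0 + d / R1 * ?h2 d * (2 * R0 - ?h2 d)))) (at d)"
    unfolding G_def[abs_def]
    by (intro DERIV_cmult DERIV_add cap h DERIV_ident DERIV_const)
  also have "1 / (4 * R0 ^ 3) *
      (3 * ((?h1 d)\<^sup>2 * 1 + (1 - d / R1) * ?h1 d * (2 * d - ?h1 d)) +
       3 * ((?h2 d)\<^sup>2 * 0 + d / R1 * ?h2 d * (2 * R0 - ?h2 d))) = g R0 R1 d"
  proof -
    have "3 / (4 * pi * R0 ^ 3) * (pi * x + y * pi * a * u + z * pi * b * v)
        = 1 / (4 * R0 ^ 3) * (3 * (x * 1 + y * a * u) + 3 * (w * 0 + z * b * v))"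
      for x y z a b u v w :: real
      using assms by (simp add: field_simps)
    then show ?thesis unfolding g_def by (rule sym)
  qed
  finally show ?thesis .
qed

text \<open>
  Both \<open>h1 (2 d - h1)\<close> and \<open>h2 (2 R0 - h2)\<close> are the squared radius of the circle in which the
  spheres meet, so the last two terms of \<open>g\<close> are a weighted mean of two equal values. What
  remains is the area \<open>2 \<pi> d h1\<close> of a spherical cap over the volume of the ball.
\<close>
lemma g_eq_cap_area:
  assumes "R0 > 0" "R1 > 0"
  shows "g R0 R1 d = 3 * d * h1 R0 R1 d / (2 * R0 ^ 3)"
proof -
  let ?h1 = "h1 R0 R1 d" and ?h2 = "h2 R0 R1 d"
  have R1: "R1 \<noteq> 0" using assms by simp
  have eq: "?h2 * (2 * R0 - ?h2) = ?h1 * (2 * d - ?h1)"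
    using arg_cong2[where f = "(*)", OF h1_factored[OF R1] h1_opposite_factored[OF R1]]
      arg_cong2[where f = "(*)", OF h2_factored[OF R1] h2_opposite_factored[OF R1]]
    by (simp only: times_divide_times_eq mult_ac)
  have mean: "pi * x + (1 - y) * pi * a * u + y * pi * b * v = pi * (x + a * u)"
    if "b * v = a * u" for x y a b u v :: real
  proof -
    have "pi * x + (1 - y) * pi * a * u + y * pi * b * v
        = pi * (x + a * u + y * (b * v - a * u))"
      by (simp add: algebra_simps)
    then show ?thesis using that by simp
  qed
  have "g R0 R1 d = 3 / (4 * pi * R0 ^ 3) * (pi * (?h1\<^sup>2 + ?h1 * (2 * d - ?h1)))"
    unfolding g_def mean[OF eq] ..
  also have "?h1\<^sup>2 + ?h1 * (2 * d - ?h1) = 2 * d * ?h1"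
    by (simp add: algebra_simps power2_eq_square)
  finally show ?thesis by simp
qed

definition dist_pdf :: "real \<Rightarrow> real \<Rightarrow> real \<Rightarrow> real" where
  "dist_pdf R0 R1 d =
     (if d < 0 \<or> d < R1 - R0 then 0
      else if d \<le> R0 - R1 then 3 * d\<^sup>2 / R0 ^ 3
      else if d \<le> R0 + R1 then g R0 R1 d
      else 0)"

text \<open>
  Clamping \<open>d\<close> to the range of each piece expresses the function by a single formula that is
  visibly continuous. The boundary values of \<open>G\<close> make the clamped pieces fit together.
\<close>
lemma continuous_dist_cdf:
  assumes R0: "R0 > 0" and R1: "R1 \<ge> 0"
  shows "continuous_on A (dist_cdf R0 R1)"
proof -
  let ?ball = "\<lambda>d. (max 0 (min d (R0 - R1))) ^ 3 / R0 ^ 3"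
  let ?lens = "\<lambda>d. G R0 R1 (max \<bar>R0 - R1\<bar> (min d (R0 + R1)))"
  show ?thesis
  proof (cases "R1 = 0")
    case True
    have "dist_cdf R0 R1 = ?ball"
      using R0 True by (auto simp: dist_cdf_def fun_eq_iff max_def min_def)
    then show ?thesis
      using R0 by (auto intro!: continuous_intros)
  next
    case False
    then have pos: "R1 > 0" using R1 by simp
    have "dist_cdf R0 R1 d = ?ball d + ?lens d - G R0 R1 \<bar>R0 - R1\<bar>" for d
    proof -
      consider "d \<le> 0 \<or> d < R1 - R0" | "0 < d" "R1 - R0 \<le> d" "d \<le> R0 - R1"
        | "\<bar>R0 - R1\<bar> \<le> d" "d \<le> R0 + R1" "R0 - R1 < d" | "0 < d" "R0 + R1 < d"
        using R0 pos by linarith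
      then show ?thesis
        using G_lower[OF R0 pos] G_upper[OF R0 pos] R0 pos
        by cases (auto simp: dist_cdf_def max_absorb1 max_absorb2 min_absorb1 min_absorb2)
    qed
    moreover have "continuous_on A ?lens"
    proof (rule continuous_on_compose2[of UNIV "G R0 R1"])
      show "continuous_on UNIV (G R0 R1)"
        using DERIV_G[OF R0 pos] by (meson DERIV_isCont continuous_at_imp_continuous_on)
    qed (auto intro!: continuous_on_max continuous_on_min)
    then have "continuous_on A (\<lambda>d. ?ball d + ?lens d - G R0 R1 \<bar>R0 - R1\<bar>)"
      using R0 by (intro continuous_on_diff continuous_on_add continuous_on_divide continuous_on_power
          continuous_on_max continuous_on_min continuous_on_const continuous_on_id) auto
    ultimately show ?thesis
      by presburger
  qed
qed

lemma DERIV_dist_cdf: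
  assumes R0: "R0 > 0" and R1: "R1 \<ge> 0" and d: "d \<notin> {0, R0 - R1, R1 - R0, R0 + R1}"
  shows "(dist_cdf R0 R1 has_real_derivative dist_pdf R0 R1 d) (at d)"
proof -
  have piece: "(dist_cdf R0 R1 has_real_derivative dist_pdf R0 R1 d) (at d)"
    if "(f has_real_derivative dist_pdf R0 R1 d) (at d)" "d \<in> {a<..<b}"
      "\<And>x. x \<in> {a<..<b} \<Longrightarrow> f x = dist_cdf R0 R1 x" for f a b
    using has_field_derivative_transform_within_open[OF that(1) _ that(2,3)] by simp
  consider "d < max 0 (R1 - R0)" | "0 < d" "R1 - R0 < d" "d < R0 - R1"
    | "\<bar>R0 - R1\<bar> < d" "d < R0 + R1" | "R0 + R1 < d"
    using R0 R1 d by fastforce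
  then show ?thesis
  proof cases
    case 1
    then show ?thesis
      by (intro piece[of "\<lambda>_. 0" "d - 1" "max 0 (R1 - R0)"]) (auto simp: dist_cdf_def dist_pdf_def)
  next
    case 2
    then have "((\<lambda>x. x ^ 3 / R0 ^ 3) has_real_derivative dist_pdf R0 R1 d) (at d)"
      using DERIV_cdivide[OF DERIV_pow[of 3 d], of "R0 ^ 3"]
      by (simp add: dist_pdf_def power2_eq_square numeral_eq_Suc)
    then show ?thesis
      using 2 by (elim piece[of _ "0" "R0 - R1"]) (auto simp: dist_cdf_def)
  next
    case 3
    then have "R1 > 0" using R0 R1 by linarith
    then have "(G R0 R1 has_real_derivative dist_pdf R0 R1 d) (at d)"
      using 3 DERIV_G[OF R0, of R1 d] by (auto simp: dist_pdf_def)
    then show ?thesis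
      using 3 by (elim piece[of _ "\<bar>R0 - R1\<bar>" "R0 + R1"]) (auto simp: dist_cdf_def)
  next
    case 4
    then show ?thesis
      using R0 R1 by (intro piece[of "\<lambda>_. 1" "R0 + R1" "d + 1"]) (auto simp: dist_cdf_def dist_pdf_def)
  qed
qed

lemma dist_pdf_nonneg:
  assumes "R0 > 0" "R1 \<ge> 0"
  shows "0 \<le> dist_pdf R0 R1 d"
proof (cases "0 \<le> d \<and> R1 - R0 \<le> d \<and> R0 - R1 < d \<and> d \<le> R0 + R1")
  case True
  then have "R1 > 0" using assms by linarith
  then have "0 \<le> g R0 R1 d"
    using True assms by (auto simp: g_eq_cap_area h1_factored intro!: divide_nonneg_pos mult_nonneg_nonneg)
  then show ?thesis using assms by (simp add: dist_pdf_def)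
qed (use assms in \<open>auto simp: dist_pdf_def\<close>)

lemma borel_measurable_dist_pdf [measurable]: "dist_pdf R0 R1 \<in> borel_measurable borel"
  unfolding dist_pdf_def[abs_def] g_def[abs_def] h1_def h2_def by measurable

text \<open>
  Since \<open>f\<close> and \<open>F\<close> vanish far to the left, integrating from \<open>-\<infinity>\<close> reduces to a compact interval;
  nonnegativity of \<open>f\<close> turns its gauge integrability there into Lebesgue integrability.
\<close>
lemma set_lebesgue_integral_atMost_FTC:
  fixes f F :: "real \<Rightarrow> real"
  assumes meas: "f \<in> borel_measurable borel" and nonneg: "\<And>x. 0 \<le> f x"
    and zero: "\<And>x. x < l \<Longrightarrow> F x = 0 \<and> f x = 0"
    and cont: "continuous_on UNIV F"
    and S: "finite S" and deriv: "\<And>x. x \<notin> S \<Longrightarrow> (F has_real_derivative f x) (at x)"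
  shows "set_integrable lborel {..d} f" and "(LINT t:{..d}|lborel. f t) = F d"
proof -
  define a where "a = min l d - 1"
  have a: "a < d" "a < l" by (auto simp: a_def)
  have "(f has_integral (F d - F a)) {a..d}"
    using a S deriv cont
    by (intro fundamental_theorem_of_calculus_interior_strong[of S])
       (auto simp: has_real_derivative_iff_has_vector_derivative[symmetric] intro: continuous_on_subset)
  then have "(f has_integral F d) {a..d}"
    using zero a by simp
  then have int: "(f has_integral F d) {..d}"
  proof (rule has_integral_spike_set_eq[THEN iffD1, rotated 2])
    have "{x \<in> {..d} - {a..d}. f x \<noteq> 0} = {}" "{x \<in> {a..d} - {..d}. f x \<noteq> 0} = {}"
      using zero a by (auto simp: not_le)
    then show "negligible {x \<in> {..d} - {a..d}. f x \<noteq> 0}" "negligible {x \<in> {a..d} - {..d}. f x \<noteq> 0}"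
      by (simp_all only: negligible_empty)
  qed
  then have "f absolutely_integrable_on {..d}"
    using nonneg by (auto intro: nonnegative_absolutely_integrable_1)
  then show *: "set_integrable lborel {..d} f"
    unfolding set_integrable_def using meas by (subst (asm) integrable_completion) auto
  show "(LINT t:{..d}|lborel. f t) = F d"
    using set_borel_integral_eq_integral(2)[OF *] int by (simp add: integral_unique)
qed

section \<open>The distribution of the distance\<close>

lemma cdf_dist_uniform:
  fixes X :: "'w \<Rightarrow> real ^ 3"
  assumes R0: "R0 > 0" and X: "uniformly_distributed M X (cball S0 R0)"
  shows "cdf (distr M borel (\<lambda>\<omega>. norm (X \<omega> - P))) d = dist_cdf R0 (norm (P - S0)) d"
proof -
  have meas: "X \<in> borel_measurable M" and distr: "distr M borel X = uniform_measure lborel (cball S0 R0)"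
    using X by (auto simp: uniformly_distributed_def)
  have vol: "measure lborel (cball S0 R0) = 4 / 3 * pi * R0 ^ 3"
    using R0 by (simp add: content_cball eval_unit_ball_vol)
  have "distr M borel (\<lambda>\<omega>. norm (X \<omega> - P))
      = distr (uniform_measure lborel (cball S0 R0)) borel (\<lambda>x. norm (x - P))"
    unfolding distr[symmetric] using meas by (subst distr_distr) (auto simp: o_def)
  moreover have "(\<lambda>x. norm (x - P)) -` {..d} = cball P d"
    by (auto simp: dist_norm norm_minus_commute)
  ultimately have "cdf (distr M borel (\<lambda>\<omega>. norm (X \<omega> - P))) d
      = measure (uniform_measure lborel (cball S0 R0)) (cball P d)"
    by (subst cdf_def, simp only:, subst measure_distr) auto
  also have "\<dots> = measure lborel (cball S0 R0 \<inter> cball P d) / measure lborel (cball S0 R0)"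
    using R0 by (intro measure_uniform_measure) (auto simp: emeasure_cball eval_unit_ball_vol)
  also have "\<dots> = dist_cdf R0 (norm (P - S0)) d"
    using R0 unfolding measure_cball_Int_cball[OF R0] vol by simp
  finally show ?thesis .
qed

theorem mainTheorem2:
  fixes M :: "'w measure"
    and X :: "'w \<Rightarrow> real ^ 3"
    and S0 P :: "real ^ 3"
    and R0 R1 :: real
    and D :: "'w \<Rightarrow> real"
    and F :: "real \<Rightarrow> real"
  assumes "prob_space M"
    and "R0 > 0"
    and "uniformly_distributed M X (cball S0 R0)"
    and "R1 = norm (P - S0)"
    and "D = (\<lambda>\<omega>. norm (X \<omega> - P))"
    and "F = cdf (distr M borel D)"
  shows "\<exists>f. is_prob_density M D f \<and>
    (R1 = 0 \<longrightarrow> (\<forall>d.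
       (d < 0 \<longrightarrow> F d = 0 \<and> f d = 0) \<and>
       (0 \<le> d \<and> d \<le> R0 \<longrightarrow> F d = d ^ 3 / R0 ^ 3 \<and> f d = 3 * d\<^sup>2 / R0 ^ 3) \<and>
       (d > R0 \<longrightarrow> F d = 1 \<and> f d = 0))) \<and>
    (0 < R1 \<and> R1 < R0 \<longrightarrow> (\<forall>d.
       (d < 0 \<longrightarrow> F d = 0 \<and> f d = 0) \<and>
       (0 \<le> d \<and> d \<le> R0 - R1 \<longrightarrow> F d = d ^ 3 / R0 ^ 3 \<and> f d = 3 * d\<^sup>2 / R0 ^ 3) \<and>
       (R0 - R1 < d \<and> d \<le> R0 + R1 \<longrightarrow> F d = G R0 R1 d \<and> f d = g R0 R1 d) \<and>
       (d > R0 + R1 \<longrightarrow> F d = 1 \<and> f d = 0))) \<and>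
    (R1 \<ge> R0 \<longrightarrow> (\<forall>d.
       (d < R1 - R0 \<longrightarrow> F d = 0 \<and> f d = 0) \<and>
       (R1 - R0 \<le> d \<and> d \<le> R1 + R0 \<longrightarrow> F d = G R0 R1 d \<and> f d = g R0 R1 d) \<and>
       (d > R1 + R0 \<longrightarrow> F d = 1 \<and> f d = 0)))"
proof -
  have R1: "R1 \<ge> 0" using assms by simp
  have F: "F = dist_cdf R0 R1"
    unfolding assms(4-6) by (rule ext) (rule cdf_dist_uniform[OF assms(2,3)])
  have "is_prob_density M D (dist_pdf R0 R1)"
    unfolding is_prob_density_def assms(6)[symmetric]
  proof (intro conjI allI)
    have zero: "dist_cdf R0 R1 x = 0 \<and> dist_pdf R0 R1 x = 0" if "x < 0" for x
      using that by (simp add: dist_cdf_def dist_pdf_def)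
    note FTC = set_lebesgue_integral_atMost_FTC[
        where S = "{0, R0 - R1, R1 - R0, R0 + R1}" and l = 0, OF borel_measurable_dist_pdf
        dist_pdf_nonneg[OF assms(2) R1] zero continuous_dist_cdf[OF assms(2) R1] _
        DERIV_dist_cdf[OF assms(2) R1]]
    show "set_integrable lborel {..d} (dist_pdf R0 R1)" for d
      by (rule FTC(1)) auto
    show "F d = (LINT t:{..d}|lborel. dist_pdf R0 R1 t)" for d
      unfolding F by (rule FTC(2)[symmetric]) auto
  qed (rule dist_pdf_nonneg[OF assms(2) R1])
  moreover
  \<comment> \<open>For \<open>R1 = R0\<close> the point \<open>d = 0\<close> belongs to both the cubic and the lens piece.\<close>
  have "d ^ 3 / R0 ^ 3 = G R0 R1 d" "3 * d\<^sup>2 / R0 ^ 3 = g R0 R1 d"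
    if "R1 \<ge> R0" "R1 - R0 \<le> d" "d \<le> R0 - R1" for d
  proof -
    have "d = 0" "R1 = R0" using that by auto
    then show "d ^ 3 / R0 ^ 3 = G R0 R1 d" "3 * d\<^sup>2 / R0 ^ 3 = g R0 R1 d"
      using G_lower[of R0 R1] g_eq_cap_area[of R0 R1 d] assms(2) by simp_all
  qed
  ultimately show ?thesis
    using assms(2) R1 unfolding F
    by (intro exI[of _ "dist_pdf R0 R1"]) (auto simp: dist_cdf_def dist_pdf_def)
qed

end
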